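(* For all integers $k\geq 1$ and $p\geq 2$, the number of dominant maximal weights of the $\mathfrak{g}(A^{(1)}_{p-1})$-module $V(k\Lambda_0)$ is $$\#\bigl(\max{}_{A^{(1)}_{p-1}}(k\Lambda_0)\cap\mathcal{P}^+_{A^{(1)}_{p-1}}\bigr)=\frac{1}{p+k}\sum_{d}\phi(d)\binom{(p+k)/d}{k/d},$$ where the sum runs over all integers $d\geq 1$ with $d\mathbb{Z}\supseteq k\mathbb{Z}$ and $d\mathbb{Z}\supseteq p\mathbb{Z}$ (i.e. over the common divisors of $k$ and $p$), and $\phi(d)=\#(\mathbb{Z}/d\mathbb{Z})^\times$ is Euler's totient function.
   Context: $\mathfrak{g}(A^{(1)}_{p-1})=\widehat{\mathfrak{sl}}_p$ is the affine Kac-Moody Lie algebra with generalized Cartan matrix $A^{(1)}_{p-1}=(2\delta_{ij}-\delta_{i+1,j}-\delta_{i-1,j})_{i,j\in\mathbb{Z}/p\mathbb{Z}}$, with simple roots $\alpha_i$, fundamental weights $\Lambda_i$ and null root $\delta=\sum_i\alpha_i$. $\mathcal{P}^+_{A}$ is the set of dominant integral weights. For $\Lambda\in\mathcal{P}^+_A$, $V(\Lambda)$ is the integrable irreducible highest weight module, $P_A(\Lambda)=\{\mu\mid V(\Lambda)_\mu\neq0\}$ is its set of weights, and $\max_A(\Lambda)=\{\lambda\in P_A(\Lambda)\mid\lambda+\delta\notin P_A(\Lambda)\}$ is its set of maximal weights. *)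

theory Defs
  imports
    Complex_Main
    "HOL-Library.Function_Algebras"
    "HOL-Number_Theory.Totient"
begin

section \<open>Linear functionals\<close>

text \<open>Functions are added pointwise (\<^theory>\<open>HOL-Library.Function_Algebras\<close>).\<close>

definition fun_scale :: "complex \<Rightarrow> ('a \<Rightarrow> complex) \<Rightarrow> 'a \<Rightarrow> complex" where
  "fun_scale c f = (\<lambda>x. c * f x)"

definition dual_space :: "(complex \<Rightarrow> 'h::ab_group_add \<Rightarrow> 'h) \<Rightarrow> ('h \<Rightarrow> complex) set" where
  "dual_space scaleH = {\<mu>. Vector_Spaces.linear scaleH (*) \<mu>}"

section \<open>Realizations of a complex square matrix\<close>

text \<open>An \<open>n \<times> n\<close> matrix is a function on \<open>nat \<times> nat\<close> of which only the entries with both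
  indices below \<open>n\<close> matter; the same holds for families indexed by \<open>{..<n}\<close>.\<close>

definition matrix_rank :: "nat \<Rightarrow> (nat \<Rightarrow> nat \<Rightarrow> int) \<Rightarrow> nat" where
  "matrix_rank n A =
     vector_space.dim fun_scale
       ((\<lambda>j i. if i < n then complex_of_int (A i j) else 0) ` {..<n})"

text \<open>The simple roots are \<open>\<alpha> i\<close> and the simple coroots \<open>\<alpha>c i\<close>; \<open>scaleH\<close> is the scalar
  multiplication of the space \<open>\<hh>\<close>. The space is the whole type
  \<open>'h\<close>; since \<open>dim\<close> is \<open>0\<close> for infinite-dimensional spaces, the dimension condition forces
  \<open>\<hh>\<close> to be finite-dimensional when \<open>n > 0\<close>.\<close>

locale realization =
  H: vector_space scaleH for scaleH :: "complex \<Rightarrow> 'h::ab_group_add \<Rightarrow> 'h" +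
  fixes n :: nat
    and A :: "nat \<Rightarrow> nat \<Rightarrow> int"
    and \<alpha>c :: "nat \<Rightarrow> 'h"
    and \<alpha> :: "nat \<Rightarrow> 'h \<Rightarrow> complex"
  assumes root_dual: "i < n \<Longrightarrow> \<alpha> i \<in> dual_space scaleH"
    and inj_root: "inj_on \<alpha> {..<n}"
    and indep_root: "\<not> module.dependent fun_scale (\<alpha> ` {..<n})"
    and inj_coroot: "inj_on \<alpha>c {..<n}"
    and indep_coroot: "\<not> module.dependent scaleH (\<alpha>c ` {..<n})"
    and root_coroot: "i < n \<Longrightarrow> j < n \<Longrightarrow> \<alpha> j (\<alpha>c i) = of_int (A i j)"
    and dim_realization: "vector_space.dim scaleH (UNIV :: 'h set) + matrix_rank n A = 2 * n"

section \<open>Lie algebras and Kac-Moody algebras\<close>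

locale lie_algebra =
  G: vector_space scaleG for scaleG :: "complex \<Rightarrow> 'g::ab_group_add \<Rightarrow> 'g" +
  fixes bracket :: "'g \<Rightarrow> 'g \<Rightarrow> 'g"
  assumes bracket_linear_left: "Vector_Spaces.linear scaleG scaleG (\<lambda>x. bracket x y)"
    and bracket_linear_right: "Vector_Spaces.linear scaleG scaleG (\<lambda>y. bracket x y)"
    and bracket_self: "bracket x x = 0"
    and jacobi:
      "bracket x (bracket y z) + bracket y (bracket z x) + bracket z (bracket x y) = 0"

definition lie_subalgebra ::
  "(complex \<Rightarrow> 'g::ab_group_add \<Rightarrow> 'g) \<Rightarrow> ('g \<Rightarrow> 'g \<Rightarrow> 'g) \<Rightarrow> 'g set \<Rightarrow> bool" where
  "lie_subalgebra scaleG bracket S \<longleftrightarrow>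
     module.subspace scaleG S \<and> (\<forall>x\<in>S. \<forall>y\<in>S. bracket x y \<in> S)"

definition lie_ideal ::
  "(complex \<Rightarrow> 'g::ab_group_add \<Rightarrow> 'g) \<Rightarrow> ('g \<Rightarrow> 'g \<Rightarrow> 'g) \<Rightarrow> 'g set \<Rightarrow> bool" where
  "lie_ideal scaleG bracket I \<longleftrightarrow>
     module.subspace scaleG I \<and> (\<forall>x. \<forall>y\<in>I. bracket x y \<in> I)"

definition lie_generated ::
  "(complex \<Rightarrow> 'g::ab_group_add \<Rightarrow> 'g) \<Rightarrow> ('g \<Rightarrow> 'g \<Rightarrow> 'g) \<Rightarrow> 'g set \<Rightarrow> 'g set" where
  "lie_generated scaleG bracket X = \<Inter>{S. lie_subalgebra scaleG bracket S \<and> X \<subseteq> S}"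

text \<open>The Lie algebra \<open>\<gg>(A)\<close> of Kac: generated by \<open>\<hh>\<close> (embedded by \<open>\<iota>\<close>) and
  \<open>e\<^sub>i\<close>, \<open>f\<^sub>i\<close>, subject to the relations below, and divided by the maximal ideal meeting \<open>\<hh>\<close>
  trivially. That this ideal has been divided out is the last assumption; together with
  generation and injectivity of \<open>\<iota>\<close> this determines \<open>\<gg>(A)\<close> up to isomorphism.\<close>

locale kac_moody_algebra =
  realization scaleH n A \<alpha>c \<alpha> + lie_algebra scaleG bracket
  for scaleH :: "complex \<Rightarrow> 'h::ab_group_add \<Rightarrow> 'h"
    and n :: nat
    and A :: "nat \<Rightarrow> nat \<Rightarrow> int"
    and \<alpha>c :: "nat \<Rightarrow> 'h"
    and \<alpha> :: "nat \<Rightarrow> 'h \<Rightarrow> complex"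
    and scaleG :: "complex \<Rightarrow> 'g::ab_group_add \<Rightarrow> 'g"
    and bracket :: "'g \<Rightarrow> 'g \<Rightarrow> 'g" +
  fixes \<iota> :: "'h \<Rightarrow> 'g"
    and e f :: "nat \<Rightarrow> 'g"
  assumes \<iota>_linear: "Vector_Spaces.linear scaleH scaleG \<iota>"
    and \<iota>_inj: "inj \<iota>"
    and bracket_e_f:
      "i < n \<Longrightarrow> j < n \<Longrightarrow> bracket (e i) (f j) = (if i = j then \<iota> (\<alpha>c i) else 0)"
    and bracket_h_h: "bracket (\<iota> h) (\<iota> h') = 0"
    and bracket_h_e: "i < n \<Longrightarrow> bracket (\<iota> h) (e i) = scaleG (\<alpha> i h) (e i)"
    and bracket_h_f: "i < n \<Longrightarrow> bracket (\<iota> h) (f i) = scaleG (- \<alpha> i h) (f i)"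
    and generated:
      "lie_generated scaleG bracket (range \<iota> \<union> e ` {..<n} \<union> f ` {..<n}) = UNIV"
    and no_ideal_avoiding_h:
      "lie_ideal scaleG bracket I \<Longrightarrow> I \<inter> range \<iota> = {0} \<Longrightarrow> I = {0}"

section \<open>Highest weight modules and their weights\<close>

locale lie_module =
  lie_algebra scaleG bracket + V: vector_space scaleV
  for scaleG :: "complex \<Rightarrow> 'g::ab_group_add \<Rightarrow> 'g"
    and bracket :: "'g \<Rightarrow> 'g \<Rightarrow> 'g"
    and scaleV :: "complex \<Rightarrow> 'v::ab_group_add \<Rightarrow> 'v" +
  fixes act :: "'g \<Rightarrow> 'v \<Rightarrow> 'v"
  assumes act_linear_left: "Vector_Spaces.linear scaleG scaleV (\<lambda>x. act x v)"
    and act_linear_right: "Vector_Spaces.linear scaleV scaleV (\<lambda>v. act x v)"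
    and act_bracket: "act (bracket x y) v = act x (act y v) - act y (act x v)"

definition submodule ::
  "(complex \<Rightarrow> 'v::ab_group_add \<Rightarrow> 'v) \<Rightarrow> ('g \<Rightarrow> 'v \<Rightarrow> 'v) \<Rightarrow> 'v set \<Rightarrow> bool" where
  "submodule scaleV act W \<longleftrightarrow> module.subspace scaleV W \<and> (\<forall>x. \<forall>w\<in>W. act x w \<in> W)"

definition irreducible_module ::
  "(complex \<Rightarrow> 'v::ab_group_add \<Rightarrow> 'v) \<Rightarrow> ('g \<Rightarrow> 'v \<Rightarrow> 'v) \<Rightarrow> bool" where
  "irreducible_module scaleV act \<longleftrightarrow>
     (UNIV :: 'v set) \<noteq> {0} \<and> (\<forall>W. submodule scaleV act W \<longrightarrow> W = {0} \<or> W = UNIV)"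

definition weight_space ::
  "(complex \<Rightarrow> 'v::ab_group_add \<Rightarrow> 'v) \<Rightarrow> ('g \<Rightarrow> 'v \<Rightarrow> 'v) \<Rightarrow> ('h \<Rightarrow> 'g)
     \<Rightarrow> ('h \<Rightarrow> complex) \<Rightarrow> 'v set" where
  "weight_space scaleV act \<iota> \<mu> = {v. \<forall>h. act (\<iota> h) v = scaleV (\<mu> h) v}"

text \<open>The subalgebra \<open>\<nn>\<^sub>+\<close> is generated by the \<open>e\<^sub>i\<close>; the last condition on the highest weight
  vector \<open>v\<close> says \<open>U(\<gg>) v = V\<close>.\<close>

locale irreducible_highest_weight_module =
  kac_moody_algebra scaleH n A \<alpha>c \<alpha> scaleG bracket \<iota> e f +
  lie_module scaleG bracket scaleV act
  for scaleH :: "complex \<Rightarrow> 'h::ab_group_add \<Rightarrow> 'h"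
    and n :: nat
    and A :: "nat \<Rightarrow> nat \<Rightarrow> int"
    and \<alpha>c :: "nat \<Rightarrow> 'h"
    and \<alpha> :: "nat \<Rightarrow> 'h \<Rightarrow> complex"
    and scaleG :: "complex \<Rightarrow> 'g::ab_group_add \<Rightarrow> 'g"
    and bracket :: "'g \<Rightarrow> 'g \<Rightarrow> 'g"
    and \<iota> :: "'h \<Rightarrow> 'g"
    and e f :: "nat \<Rightarrow> 'g"
    and scaleV :: "complex \<Rightarrow> 'v::ab_group_add \<Rightarrow> 'v"
    and act :: "'g \<Rightarrow> 'v \<Rightarrow> 'v" +
  fixes \<Lambda> :: "'h \<Rightarrow> complex"
  assumes highest_weight_dual: "\<Lambda> \<in> dual_space scaleH"
    and irreducible: "irreducible_module scaleV act"
    and highest_weight_vector: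
      "\<exists>v. v \<noteq> 0 \<and> v \<in> weight_space scaleV act \<iota> \<Lambda> \<and>
         (\<forall>x \<in> lie_generated scaleG bracket (e ` {..<n}). act x v = 0) \<and>
         \<Inter>{W. submodule scaleV act W \<and> v \<in> W} = UNIV"

definition weights ::
  "(complex \<Rightarrow> 'h::ab_group_add \<Rightarrow> 'h) \<Rightarrow> (complex \<Rightarrow> 'v::ab_group_add \<Rightarrow> 'v)
     \<Rightarrow> ('g \<Rightarrow> 'v \<Rightarrow> 'v) \<Rightarrow> ('h \<Rightarrow> 'g) \<Rightarrow> ('h \<Rightarrow> complex) set" where
  "weights scaleH scaleV act \<iota> =
     {\<mu> \<in> dual_space scaleH. weight_space scaleV act \<iota> \<mu> \<noteq> {0}}"

definition maximal_weights ::
  "('h \<Rightarrow> complex) set \<Rightarrow> ('h \<Rightarrow> complex) \<Rightarrow> ('h \<Rightarrow> complex) set" where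
  "maximal_weights P \<delta> = {\<mu> \<in> P. \<mu> + \<delta> \<notin> P}"

definition dominant_integral_weights ::
  "(complex \<Rightarrow> 'h::ab_group_add \<Rightarrow> 'h) \<Rightarrow> nat \<Rightarrow> (nat \<Rightarrow> 'h) \<Rightarrow> ('h \<Rightarrow> complex) set" where
  "dominant_integral_weights scaleH n \<alpha>c =
     {\<mu> \<in> dual_space scaleH. \<forall>i<n. \<mu> (\<alpha>c i) \<in> \<nat>}"

text \<open>The fundamental weight \<open>\<Lambda>\<^sub>i\<close> is prescribed on the simple coroots only. In the affine case
  this fixes it up to a multiple of the null root; normalizing it on a scaling element is one
  admissible choice.\<close>

definition fundamental_weight ::
  "(complex \<Rightarrow> 'h::ab_group_add \<Rightarrow> 'h) \<Rightarrow> nat \<Rightarrow> (nat \<Rightarrow> 'h) \<Rightarrow> nat \<Rightarrow> ('h \<Rightarrow> complex) \<Rightarrow> bool" where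
  "fundamental_weight scaleH n \<alpha>c i \<mu> \<longleftrightarrow>
     \<mu> \<in> dual_space scaleH \<and> (\<forall>j<n. \<mu> (\<alpha>c j) = (if j = i then 1 else 0))"

section \<open>The affine type \<open>A\<close>\<close>

text \<open>The matrix with entries \<open>2\<delta>\<^sub>i\<^sub>j - \<delta>\<^bsub>i+1,j\<^esub> - \<delta>\<^bsub>i-1,j\<^esub>\<close>, where \<open>\<int>/p\<int>\<close> is represented by
  \<open>{..<p}\<close>; the condition \<open>i - 1 = j\<close> is written \<open>j + 1 = i\<close>. For \<open>p = 2\<close> the off-diagonal
  entries are \<open>-2\<close>.\<close>

definition affine_A :: "nat \<Rightarrow> nat \<Rightarrow> nat \<Rightarrow> int" where
  "affine_A p i j =
     2 * of_bool (i = j) - of_bool ((i + 1) mod p = j) - of_bool ((j + 1) mod p = i)"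

definition null_root :: "nat \<Rightarrow> (nat \<Rightarrow> 'h \<Rightarrow> complex) \<Rightarrow> 'h \<Rightarrow> complex" where
  "null_root p \<alpha> = (\<Sum>i<p. \<alpha> i)"

end

theory Submission
  imports
    Defs
    "HOL-Computational_Algebra.Formal_Laurent_Series"
    "HOL-Computational_Algebra.Polynomial_FPS"
begin

text \<open>Let \<open>\<Lambda> = k\<Lambda>\<^sub>0\<close>. In a module generated by a vector of highest weight \<open>\<Lambda>\<close>, every weight
  has the form \<open>\<Lambda> - \<Sum>\<^sub>i b\<^sub>i \<alpha>\<^sub>i\<close> with natural numbers \<open>b\<^sub>i\<close> (\<open>weight_below\<close>), and for a
  positive level \<open>k\<close> every dominant functional of this form is a weight
  (\<open>dominant_below_is_weight\<close>). The latter rests on two facts. If \<open>\<mu>\<close> is a weight with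
  \<open>\<mu>(\<alpha>\<^sub>i\<^sup>\<or>) > 0\<close>, then \<open>\<mu> - \<alpha>\<^sub>i\<close> is a weight, by \<open>\<ss>\<ll>\<^sub>2\<close> theory (\<open>weight_minus_root\<close>). And the
  affine Cartan matrix is positive semidefinite with the constant vectors as kernel
  (\<open>constant_if_cartan_image_nonpos\<close>), so that descending from \<open>\<Lambda>\<close> towards a dominant functional
  by simple roots can get stuck only at a weight of level \<open>0\<close>.

  Adding the null root to \<open>\<Lambda> - \<Sum>\<^sub>i b\<^sub>i \<alpha>\<^sub>i\<close> lowers each \<open>b\<^sub>i\<close> by one and does not affect
  dominance. By linear independence of the simple roots, the dominant maximal weights therefore
  correspond to the vectors \<open>b\<close> with minimum \<open>0\<close> for which the functional is dominant
  (\<open>dominant_maximal_weights\<close>).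

  Such a vector \<open>b\<close> is determined by the labels \<open>m\<^sub>i\<close>, the values of the functional on the
  coroots: the labels determine \<open>b\<close> up to a constant, which the minimum fixes. The \<open>m\<^sub>i\<close> are
  natural numbers with sum \<open>k\<close>, and the cokernel of the affine Cartan matrix leaves just one
  more condition on them, namely that \<open>p\<close> divides \<open>\<Sum>\<^sub>i i m\<^sub>i\<close> (\<open>card_reduced_admissible\<close>).

  It remains to count these compositions of \<open>k\<close>
  (\<open>card_compositions_weighted_sum_dvd\<close>). Averaging over the \<open>p\<close>-th roots of unity detects the
  divisibility. For a root \<open>\<omega>\<close> of order \<open>d\<close>, the sum of \<open>\<omega>\<close> to the power \<open>\<Sum>\<^sub>i i m\<^sub>i\<close> over all
  compositions is the coefficient of \<open>X\<^sup>k\<close> in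
  \<open>\<Prod>\<^sub>i 1 / (1 - \<omega>\<^sup>i X) = (1 - X\<^sup>d)\<close> to the power \<open>- p / d\<close>. It vanishes unless \<open>d\<close> divides \<open>k\<close>,
  and otherwise it is a binomial coefficient; \<open>\<phi>(d)\<close> of the roots have order \<open>d\<close>.\<close>

section \<open>Compositions with a weighted sum divisible by \<open>p\<close>\<close>

lemma prod_geometric_fps_nth:
  fixes c :: "nat \<Rightarrow> 'a::comm_ring_1"
  assumes "p > 0"
  shows "(\<Prod>j<p. Abs_fps (\<lambda>n. c j ^ n)) $ k = (\<Sum>v\<in>natpermute k p. \<Prod>j<p. c j ^ (v ! j))"
proof -
  obtain m where p: "p = Suc m" using assms by (cases p) auto
  have *: "{..<p} = {0..m}" using p by auto
  show ?thesis unfolding * fps_prod_nth by (simp add: p)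
qed

text \<open>Both sides come from polynomials of degree at most \<open>d\<close> which agree at the \<open>d\<close> powers of
  \<open>inverse \<omega>\<close> and at \<open>0\<close>, that is, at more points than their degree.\<close>
lemma prod_one_minus_roots_of_unity:
  fixes \<omega> :: complex
  assumes "d > 0" and ord: "\<And>i. \<omega> ^ i = 1 \<longleftrightarrow> d dvd i"
  shows "(\<Prod>j<d. 1 - fps_const (\<omega> ^ j) * fps_X) = 1 - fps_X ^ d"
proof -
  have w0: "\<omega> \<noteq> 0" using ord[of d] assms(1) by (auto simp: power_0_left)
  define R where "R = (\<lambda>j. inverse \<omega> ^ j) ` {..<d}"
  have inj: "inj_on (\<lambda>j. inverse \<omega> ^ j) {..<d}"
  proof (rule linorder_inj_onI)
    fix i j assume ij: "i < j" "i \<in> {..<d}" "j \<in> {..<d}"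
    have "\<omega> ^ (j - i) \<noteq> 1" using ij ord[of "j - i"] by (auto dest: dvd_imp_le)
    then show "inverse \<omega> ^ i \<noteq> inverse \<omega> ^ j"
      using ij w0 by (auto simp: power_diff power_inverse)
  qed auto
  have card: "card (insert 0 R) = Suc d"
    using w0 inj by (subst card_insert_disjoint) (auto simp: R_def card_image)
  have wd: "\<omega> ^ d = 1" using ord by simp
  have deg: "degree (\<Prod>j<d. [:1, - (\<omega> ^ j):]) \<le> d"
    by (rule order.trans[OF degree_prod_sum_le]) (auto simp: degree_pCons_eq_if intro: order.trans[OF sum_mono[of _ _ "\<lambda>_. 1"]])
  have "(\<Prod>j<d. [:1, - (\<omega> ^ j):]) = 1 - monom 1 d"
  proof (rule poly_eqI_degree)
    fix x assume "x \<in> insert 0 R"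
    then consider "x = 0" | j where "j < d" "x = inverse \<omega> ^ j" by (auto simp: R_def)
    then show "poly (\<Prod>j<d. [:1, - (\<omega> ^ j):]) x = poly (1 - monom 1 d) x"
    proof cases
      case 1
      then show ?thesis using assms(1) by (simp add: poly_prod poly_monom power_0_left)
    next
      case 2
      have "(\<Prod>i<d. poly [:1, - (\<omega> ^ i):] x) = 0"
        using 2 w0 by (intro prod_zero) (auto intro!: bexI[of _ j] simp: power_inverse)
      moreover have "x ^ d = 1"
        using wd 2 by (simp add: power_inverse flip: power_mult) (simp add: mult.commute[of j] power_mult wd)
      ultimately show ?thesis by (simp only: poly_prod poly_diff poly_1 poly_monom) simp
    qed
  next
    show "degree (\<Prod>j<d. [:1, - (\<omega> ^ j):]) < card (insert 0 R)" using deg card by simp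
    show "degree (1 - monom (1::complex) d) < card (insert 0 R)"
      using card degree_diff_le[of 1 d "monom (1::complex) d"] by (simp add: degree_monom_le)
  qed
  then have "fps_of_poly (\<Prod>j<d. [:1, - (\<omega> ^ j):]) = fps_of_poly (1 - monom 1 d)" by simp
  then show ?thesis
    by (simp add: fps_of_poly_prod fps_of_poly_linear' fps_of_poly_diff fps_of_poly_monom'
        flip: fps_const_neg)
qed

text \<open>The left-hand side is a coefficient of the generating function
  \<open>\<Prod>\<^sub>j 1 / (1 - \<omega>\<^sup>j X)\<close>. The factors repeat with period \<open>d\<close>, so this is
  \<open>1 / (1 - X\<^sup>d)\<close> to the power \<open>p / d\<close>, and the negative binomial series applies.\<close>
lemma natpermute_root_of_unity_sum:
  fixes \<omega> :: complex
  assumes "p > 0" "d dvd p" and ord: "\<And>i. \<omega> ^ i = 1 \<longleftrightarrow> d dvd i"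
  shows "(\<Sum>v\<in>natpermute k p. \<omega> ^ (\<Sum>j<p. j * v ! j))
       = (if d dvd k then of_nat ((p div d + k div d - 1) choose (k div d)) else 0)"
proof -
  have d: "d > 0" using assms by (auto intro!: gr0I)
  define a where "a = p div d"
  have p: "p = a * d" using assms by (simp add: a_def)
  have a: "a > 0" using assms(1) p by simp
  have geo: "Abs_fps (\<lambda>n. c ^ n) = inverse (1 - fps_const c * fps_X)" for c :: complex
    using one_minus_const_fps_X_neg_power'[of 1 c] by simp
  have wd: "\<omega> ^ d = 1" using ord by simp
  have "(\<Prod>j<p. 1 - fps_const (\<omega> ^ j) * fps_X)
      = (\<Prod>m<a. \<Prod>j\<in>{m*d..<m*d+d}. 1 - fps_const (\<omega> ^ j) * fps_X)"
    unfolding p prod.nat_group ..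
  also have "\<dots> = (\<Prod>m<a. \<Prod>j<d. 1 - fps_const (\<omega> ^ j) * fps_X)"
  proof (rule prod.cong[OF refl])
    fix m
    have w: "\<omega> ^ (j + m * d) = \<omega> ^ j" for j
      by (simp add: power_add mult.commute[of m] power_mult wd)
    have "(\<Prod>j\<in>{m*d..<m*d+d}. 1 - fps_const (\<omega> ^ j) * fps_X)
        = (\<Prod>j\<in>{0+m*d..<d+m*d}. 1 - fps_const (\<omega> ^ j) * fps_X)" by (simp add: add.commute)
    also have "\<dots> = (\<Prod>j\<in>{0..<d}. 1 - fps_const (\<omega> ^ (j + m*d)) * fps_X)"
      by (rule prod.shift_bounds_nat_ivl)
    finally show "(\<Prod>j\<in>{m*d..<m*d+d}. 1 - fps_const (\<omega> ^ j) * fps_X)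
        = (\<Prod>j<d. 1 - fps_const (\<omega> ^ j) * fps_X)" by (simp only: w lessThan_atLeast0)
  qed
  also have "\<dots> = (1 - fps_X ^ d) ^ a"
    using prod_one_minus_roots_of_unity[OF d ord] by simp
  finally have P: "(\<Prod>j<p. 1 - fps_const (\<omega> ^ j) * fps_X) = (1 - fps_X ^ d) ^ a" .
  have "(\<Sum>v\<in>natpermute k p. \<omega> ^ (\<Sum>j<p. j * v ! j))
      = (\<Sum>v\<in>natpermute k p. \<Prod>j<p. (\<omega> ^ j) ^ (v ! j))"
    by (simp add: power_sum power_mult)
  also have "\<dots> = (\<Prod>j<p. Abs_fps (\<lambda>n. (\<omega> ^ j) ^ n)) $ k"
    by (rule prod_geometric_fps_nth[symmetric]) fact
  also have "(\<Prod>j<p. Abs_fps (\<lambda>n. (\<omega> ^ j) ^ n)) = inverse (\<Prod>j<p. 1 - fps_const (\<omega> ^ j) * fps_X)"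
    unfolding geo by (induction p) (simp_all add: fps_inverse_mult)
  also have "\<dots> = inverse ((1 - fps_const 1 * fps_X) ^ a) oo (fps_X ^ d)"
    unfolding P using d by (subst fps_inverse_compose)
      (simp_all add: fps_compose_power[symmetric] fps_compose_sub_distrib)
  also have "\<dots> $ k = (if d dvd k then of_nat ((p div d + k div d - 1) choose (k div d)) else 0)"
    using d a by (subst one_minus_const_fps_X_neg_power')
      (simp_all add: fps_nth_compose_X_power a_def)
  finally show ?thesis .
qed

lemma primitive_root_power_eq_1_iff:
  assumes "p > 0"
  shows "cis (2 * pi / real p) ^ i = 1 \<longleftrightarrow> p dvd i"
proof -
  define z where "z = cis (2 * pi / real p)"
  have z: "z ^ j = cis (2 * pi * real j / real p)" for j
    by (simp add: z_def DeMoivre mult.commute)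
  have zp: "z ^ p = 1" using assms by (simp add: z)
  have "z ^ i = z ^ (i mod p + p * (i div p))" by simp
  also have "\<dots> = z ^ (i mod p)" by (simp only: power_add power_mult zp) simp
  finally have "z ^ i = z ^ (i mod p)" .
  moreover have "z ^ (i mod p) = z ^ 0 \<longleftrightarrow> i mod p = 0"
    using bij_betw_imp_inj_on[OF bij_betw_roots_unity[OF assms]] assms
    unfolding z by (subst inj_on_eq_iff[where A = "{..<p}" and f = "\<lambda>k. cis (2 * pi * real k / real p)"]) auto
  ultimately show ?thesis by (simp add: z_def dvd_eq_mod_eq_0)
qed

text \<open>Here \<open>p div gcd t p\<close> is the order of the \<open>t\<close>-th power of a primitive \<open>p\<close>-th root of unity.\<close>
lemma sum_over_gcd_classes:
  fixes g :: "nat \<Rightarrow> 'a::comm_semiring_1"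
  assumes "p > 0"
  shows "(\<Sum>t\<in>{0<..p}. g (p div gcd t p)) = (\<Sum>d | d dvd p. of_nat (totient d) * g d)"
proof -
  have "(\<Sum>t\<in>{0<..p}. g (p div gcd t p))
      = (\<Sum>d | d dvd p. \<Sum>t | t \<in> {0<..p} \<and> p div gcd t p = d. g (p div gcd t p))"
    using assms by (intro sum.group[symmetric]) (auto simp: div_dvd_iff_mult)
  also have "\<dots> = (\<Sum>d | d dvd p. of_nat (totient d) * g d)"
  proof (rule sum.cong[OF refl])
    fix d assume "d \<in> {d. d dvd p}"
    then have d: "d dvd p" by simp
    have "p div x = d \<longleftrightarrow> x = p div d" if "x dvd p" for x
      using that d assms by (auto elim!: dvdE)
    then have "{t \<in> {0<..p}. p div gcd t p = d} = {t \<in> {0<..p}. gcd t p = p div d}" by auto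
    moreover have "card {t \<in> {0<..p}. gcd t p = p div d} = totient (p div (p div d))"
      using assms d by (intro card_gcd_eq_totient) (auto simp: div_dvd_iff_mult)
    moreover have "p div (p div d) = d" using d assms by (auto elim!: dvdE)
    ultimately have "card {t \<in> {0<..p}. p div gcd t p = d} = totient d" by simp
    then show "(\<Sum>t | t \<in> {0<..p} \<and> p div gcd t p = d. g (p div gcd t p)) = of_nat (totient d) * g d"
      by simp
  qed
  finally show ?thesis .
qed

text \<open>Roots of unity filter: the sum of \<open>\<omega>\<^sup>s\<close> over all \<open>p\<close>-th roots of unity \<open>\<omega>\<close> is \<open>p\<close> if \<open>p\<close>
  divides \<open>s\<close>, and \<open>0\<close> otherwise. The roots are then grouped by their order \<open>d\<close>.\<close>
lemma card_compositions_weighted_sum_dvd: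
  assumes "p > 0"
  shows "real (card {v \<in> natpermute k p. p dvd (\<Sum>j<p. j * v ! j)})
       = 1 / real (p + k) *
           (\<Sum>d | d dvd k \<and> d dvd p. real (totient d) * real (((p + k) div d) choose (k div d)))"
proof -
  define \<zeta> where "\<zeta> = cis (2 * pi / real p)"
  have \<zeta>: "\<zeta> ^ i = 1 \<longleftrightarrow> p dvd i" for i
    unfolding \<zeta>_def by (rule primitive_root_power_eq_1_iff[OF assms])
  define G :: "nat \<Rightarrow> nat" where
    "G d = (if d dvd k then (p div d + k div d - 1) choose (k div d) else 0)" for d
  have filter: "(\<Sum>t\<in>{0<..p}. (\<zeta> ^ t) ^ s) = (if p dvd s then of_nat p else 0)" for s
  proof -
    define z where "z = \<zeta> ^ s"
    have "(\<zeta> ^ t) ^ s = z ^ t" for t by (simp add: z_def mult.commute flip: power_mult)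
    then have "(\<Sum>t\<in>{0<..p}. (\<zeta> ^ t) ^ s) = (\<Sum>t\<in>{Suc 0..<Suc p}. z ^ t)"
      by (intro sum.cong) auto
    also have "\<dots> = (\<Sum>t<p. z * z ^ t)"
      by (simp only: sum.shift_bounds_Suc_ivl power_Suc lessThan_atLeast0)
    finally have sum: "(\<Sum>t\<in>{0<..p}. (\<zeta> ^ t) ^ s) = z * (\<Sum>t<p. z ^ t)"
      by (simp add: sum_distrib_left)
    show ?thesis
    proof (cases "p dvd s")
      case True
      then have "z = 1" using \<zeta> by (simp add: z_def)
      then show ?thesis using sum True by simp
    next
      case False
      then have "z \<noteq> 1" using \<zeta> by (simp add: z_def)
      moreover have "z ^ p = 1" using \<zeta> by (simp add: z_def flip: power_mult)
      ultimately have "(\<Sum>t<p. z ^ t) = 0" by (simp add: geometric_sum)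
      then show ?thesis using sum False by simp
    qed
  qed
  have "of_nat (p * card {v \<in> natpermute k p. p dvd (\<Sum>j<p. j * v ! j)})
      = (\<Sum>v\<in>natpermute k p. if p dvd (\<Sum>j<p. j * v ! j) then of_nat p else (0::complex))"
    by (simp add: sum.If_cases natpermute_finite Collect_conj_eq mult.commute)
  also have "\<dots> = (\<Sum>t\<in>{0<..p}. \<Sum>v\<in>natpermute k p. (\<zeta> ^ t) ^ (\<Sum>j<p. j * v ! j))"
    by (subst sum.swap) (simp only: filter)
  also have "\<dots> = (\<Sum>t\<in>{0<..p}. of_nat (G (p div gcd t p)))"
  proof (rule sum.cong[OF refl])
    fix t assume t: "t \<in> {0<..p}"
    have "(\<zeta> ^ t) ^ i = 1 \<longleftrightarrow> p div gcd t p dvd i" for i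
    proof -
      have "(\<zeta> ^ t) ^ i = 1 \<longleftrightarrow> p dvd t * i" using \<zeta> by (simp flip: power_mult)
      also have "\<dots> \<longleftrightarrow> gcd t p * (p div gcd t p) dvd gcd t p * ((t div gcd t p) * i)"
        by (simp flip: mult.assoc)
      also have "\<dots> \<longleftrightarrow> p div gcd t p dvd (t div gcd t p) * i"
        using t by (intro dvd_times_left_cancel_iff) simp
      also have "\<dots> \<longleftrightarrow> p div gcd t p dvd i"
        using t div_gcd_coprime[of t p]
        by (intro coprime_dvd_mult_right_iff) (auto simp: coprime_commute)
      finally show ?thesis .
    qed
    then show "(\<Sum>v\<in>natpermute k p. (\<zeta> ^ t) ^ (\<Sum>j<p. j * v ! j)) = of_nat (G (p div gcd t p))"
      using assms by (subst natpermute_root_of_unity_sum[of p "p div gcd t p"])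
        (auto simp: G_def div_dvd_iff_mult)
  qed
  also have "\<dots> = of_nat (\<Sum>t\<in>{0<..p}. G (p div gcd t p))" by simp
  finally have "p * card {v \<in> natpermute k p. p dvd (\<Sum>j<p. j * v ! j)}
      = (\<Sum>t\<in>{0<..p}. G (p div gcd t p))" by (simp only: of_nat_eq_iff)
  also have "\<dots> = (\<Sum>d | d dvd p. totient d * G d)"
    using sum_over_gcd_classes[OF assms, of G] by simp
  also have "\<dots> = (\<Sum>d | d dvd k \<and> d dvd p. totient d * G d)"
    using assms by (intro sum.mono_neutral_right) (auto simp: G_def)
  finally have main: "p * card {v \<in> natpermute k p. p dvd (\<Sum>j<p. j * v ! j)}
      = (\<Sum>d | d dvd k \<and> d dvd p. totient d * G d)" .
  \<comment> \<open>With \<open>p = d a\<close> and \<open>k = d b\<close>, this is \<open>a ((a+b) choose b) = (a+b) ((a+b-1) choose b)\<close>.\<close>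
  have absorb: "real (G d) = real p / real (p + k) * real (((p + k) div d) choose (k div d))"
    if dvd: "d dvd k" "d dvd p" for d
  proof -
    obtain a b where ab: "p = d * a" "k = d * b" using dvd by (auto elim!: dvdE)
    have d: "d > 0" "a > 0" using assms ab by auto
    have "(a + b - b) * ((a + b) choose b) = (a + b) * ((a + b - 1) choose b)"
      by (rule binomial_absorb_comp)
    then have eq: "real a * real ((a + b) choose b) = real (a + b) * real ((a + b - 1) choose b)"
      by (metis add_diff_cancel_right' of_nat_mult)
    have "real (G d) = real ((a + b - 1) choose b)"
      using ab d by (simp add: G_def)
    also have "\<dots> = real a / real (a + b) * real ((a + b) choose b)"
      using eq d by (simp add: divide_simps)
    finally have "real (G d) = real a / real (a + b) * real ((a + b) choose b)" .
    moreover have "(p + k) div d = a + b" using ab d by (simp flip: distrib_left)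
    moreover have "real p / real (p + k) = real a / real (a + b)"
      unfolding ab distrib_left[symmetric] of_nat_mult using d by simp
    moreover have "k div d = b" using ab d by simp
    ultimately show ?thesis by (simp only: mult.assoc)
  qed
  have "real p * real (card {v \<in> natpermute k p. p dvd (\<Sum>j<p. j * v ! j)})
      = (\<Sum>d | d dvd k \<and> d dvd p. real (totient d) * real (G d))"
    using arg_cong[OF main, of real] by simp
  also have "\<dots> = (\<Sum>d | d dvd k \<and> d dvd p. real p * (1 / real (p + k) *
      (real (totient d) * real (((p + k) div d) choose (k div d)))))"
    by (intro sum.cong refl) (auto simp: absorb)
  also have "\<dots> = real p * (1 / real (p + k) *
      (\<Sum>d | d dvd k \<and> d dvd p. real (totient d) * real (((p + k) div d) choose (k div d))))"
    by (simp only: sum_distrib_left)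
  finally show ?thesis
    by (rule mult_left_cancel[THEN iffD1, rotated]) (use assms in simp)
qed

section \<open>Weights of highest weight modules\<close>

text \<open>The highest weight vector is made a parameter, so that its descendants under the \<open>f\<^sub>i\<close> can be
  named.\<close>
locale highest_weight_module =
  kac_moody_algebra scaleH n A \<alpha>c \<alpha> scaleG bracket \<iota> e f +
  lie_module scaleG bracket scaleV act
  for scaleH :: "complex \<Rightarrow> 'h::ab_group_add \<Rightarrow> 'h"
    and n :: nat
    and A :: "nat \<Rightarrow> nat \<Rightarrow> int"
    and \<alpha>c :: "nat \<Rightarrow> 'h"
    and \<alpha> :: "nat \<Rightarrow> 'h \<Rightarrow> complex"
    and scaleG :: "complex \<Rightarrow> 'g::ab_group_add \<Rightarrow> 'g"
    and bracket :: "'g \<Rightarrow> 'g \<Rightarrow> 'g"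
    and \<iota> :: "'h \<Rightarrow> 'g"
    and e f :: "nat \<Rightarrow> 'g"
    and scaleV :: "complex \<Rightarrow> 'v::ab_group_add \<Rightarrow> 'v"
    and act :: "'g \<Rightarrow> 'v \<Rightarrow> 'v" +
  fixes \<Lambda> :: "'h \<Rightarrow> complex" and v\<^sub>0 :: 'v
  assumes \<Lambda>_dual: "\<Lambda> \<in> dual_space scaleH"
    and v\<^sub>0_nonzero: "v\<^sub>0 \<noteq> 0"
    and v\<^sub>0_weight: "v\<^sub>0 \<in> weight_space scaleV act \<iota> \<Lambda>"
    and act_e_v\<^sub>0: "i < n \<Longrightarrow> act (e i) v\<^sub>0 = 0"
    and v\<^sub>0_generates: "submodule scaleV act W \<Longrightarrow> v\<^sub>0 \<in> W \<Longrightarrow> W = UNIV"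
begin

abbreviation weight_vectors :: "('h \<Rightarrow> complex) \<Rightarrow> 'v set" where
  "weight_vectors \<equiv> weight_space scaleV act \<iota>"

definition below :: "(nat \<Rightarrow> nat) \<Rightarrow> 'h \<Rightarrow> complex" where
  "below b = (\<lambda>h. \<Lambda> h - (\<Sum>i<n. of_nat (b i) * \<alpha> i h))"

lemma act_add: "act x (u + w) = act x u + act x w"
  using act_linear_right[of x] by (simp add: Vector_Spaces.linear_iff)

lemma act_scale: "act x (scaleV c u) = scaleV c (act x u)"
  using act_linear_right[of x] by (simp add: Vector_Spaces.linear_iff)

lemma act_zero [simp]: "act x 0 = 0"
  using act_scale[of x 0 0] by simp

lemma act_sum: "act x (\<Sum>i\<in>I. u i) = (\<Sum>i\<in>I. act x (u i))"
  by (induction I rule: infinite_finite_induct) (simp_all add: act_add)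

lemma act_add_left: "act (x + y) u = act x u + act y u"
  using act_linear_left[of u] by (simp add: Vector_Spaces.linear_iff)

lemma act_scale_left: "act (scaleG c x) u = scaleV c (act x u)"
  using act_linear_left[of u] by (simp add: Vector_Spaces.linear_iff)

lemma act_zero_left [simp]: "act 0 u = 0"
  using act_scale_left[of 0 0] by simp

lemma weight_vectors_iff: "u \<in> weight_vectors \<mu> \<longleftrightarrow> (\<forall>h. act (\<iota> h) u = scaleV (\<mu> h) u)"
  by (simp add: weight_space_def)

lemma act_e_weight:
  assumes "u \<in> weight_vectors \<mu>" "i < n"
  shows "act (e i) u \<in> weight_vectors (\<lambda>h. \<mu> h + \<alpha> i h)"
  unfolding weight_vectors_iff
proof
  fix h
  have "act (\<iota> h) (act (e i) u) = act (bracket (\<iota> h) (e i)) u + act (e i) (act (\<iota> h) u)"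
    by (simp add: act_bracket)
  also have "\<dots> = scaleV (\<mu> h + \<alpha> i h) (act (e i) u)"
    using assms by (simp add: bracket_h_e act_scale_left act_scale weight_vectors_iff V.scale_left_distrib)
  finally show "act (\<iota> h) (act (e i) u) = scaleV (\<mu> h + \<alpha> i h) (act (e i) u)" .
qed

lemma act_f_weight:
  assumes "u \<in> weight_vectors \<mu>" "i < n"
  shows "act (f i) u \<in> weight_vectors (\<lambda>h. \<mu> h - \<alpha> i h)"
  unfolding weight_vectors_iff
proof
  fix h
  have "act (\<iota> h) (act (f i) u) = act (bracket (\<iota> h) (f i)) u + act (f i) (act (\<iota> h) u)"
    by (simp add: act_bracket)
  also have "\<dots> = scaleV (\<mu> h - \<alpha> i h) (act (f i) u)"
    unfolding bracket_h_f[OF assms(2)] act_scale_left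
    using assms by (simp add: act_scale weight_vectors_iff V.scale_left_diff_distrib)
  finally show "act (\<iota> h) (act (f i) u) = scaleV (\<mu> h - \<alpha> i h) (act (f i) u)" .
qed

text \<open>Weight vectors of different weights are linearly independent. Subtracting from the action of a
  suitable \<open>h\<close> its eigenvalue on the \<open>j\<close>-th summand removes this summand from the sum but only
  rescales the sum itself, by a nonzero factor; hence the induction. Different summands may share a
  weight.\<close>
lemma weight_vector_eq_sum_imp_zero:
  assumes "finite I" "\<And>i. i \<in> I \<Longrightarrow> u i \<in> weight_vectors (\<nu> i)" "\<And>i. i \<in> I \<Longrightarrow> \<nu> i \<noteq> \<mu>"
    and "(\<Sum>i\<in>I. u i) \<in> weight_vectors \<mu>"
  shows "(\<Sum>i\<in>I. u i) = 0"
  using assms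
proof (induction I arbitrary: u rule: finite_induct)
  case (insert j J)
  obtain h where h: "\<nu> j h \<noteq> \<mu> h" using insert.prems(2)[of j] by auto
  define w where "w i = scaleV (\<nu> i h - \<nu> j h) (u i)" for i
  define s where "s = (\<Sum>i\<in>insert j J. u i)"
  have act_u: "act (\<iota> h') (u i) = scaleV (\<nu> i h') (u i)" if "i \<in> insert j J" for h' i
    using insert.prems(1)[OF that] by (simp add: weight_vectors_iff)
  have act_s: "act (\<iota> h') s = scaleV (\<mu> h') s" for h'
    using insert.prems(3) unfolding s_def weight_vectors_iff by blast
  have "scaleV (\<mu> h - \<nu> j h) s = act (\<iota> h) s - scaleV (\<nu> j h) s"
    by (simp add: act_s V.scale_left_diff_distrib)
  also have "\<dots> = (\<Sum>i\<in>insert j J. w i)"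
    unfolding s_def act_sum V.scale_sum_right sum_subtractf[symmetric] w_def
    by (intro sum.cong refl) (simp add: act_u V.scale_left_diff_distrib)
  also have "\<dots> = (\<Sum>i\<in>J. w i)" using insert.hyps by (simp add: w_def)
  finally have eq: "scaleV (\<mu> h - \<nu> j h) s = (\<Sum>i\<in>J. w i)" .
  have "(\<Sum>i\<in>J. w i) = 0"
  proof (rule insert.IH)
    show "w i \<in> weight_vectors (\<nu> i)" if "i \<in> J" for i
      using that by (simp add: weight_vectors_iff w_def act_scale act_u V.scale_left_commute)
    show "\<nu> i \<noteq> \<mu>" if "i \<in> J" for i using insert.prems(2) that by simp
    show "(\<Sum>i\<in>J. w i) \<in> weight_vectors \<mu>"
      unfolding eq[symmetric] weight_vectors_iff
      by (simp add: act_scale act_s V.scale_left_commute)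
  qed
  then have "scaleV (\<mu> h - \<nu> j h) s = 0" using eq by simp
  then show ?case using h by (simp add: s_def)
qed simp

inductive_set monomials :: "'v set" where
  base: "v\<^sub>0 \<in> monomials"
| lower: "u \<in> monomials \<Longrightarrow> i < n \<Longrightarrow> act (f i) u \<in> monomials"

lemma below_zero: "below (\<lambda>_. 0) = \<Lambda>"
  by (simp add: below_def)

lemma below_add_at:
  assumes "i < n"
  shows "below (b(i := b i + m)) = (\<lambda>h. below b h - of_nat m * \<alpha> i h)"
proof
  fix h
  have "(\<Sum>j<n. of_nat ((b(i := b i + m)) j) * \<alpha> j h)
      = (\<Sum>j<n. of_nat (b j) * \<alpha> j h + (if j = i then of_nat m * \<alpha> i h else 0))"
    by (intro sum.cong) (auto simp: algebra_simps)
  also have "\<dots> = (\<Sum>j<n. of_nat (b j) * \<alpha> j h) + of_nat m * \<alpha> i h"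
    using assms by (simp add: sum.distrib)
  finally show "below (b(i := b i + m)) h = below b h - of_nat m * \<alpha> i h"
    by (simp add: below_def)
qed

lemma monomial_weight: "u \<in> monomials \<Longrightarrow> \<exists>b. u \<in> weight_vectors (below b)"
proof (induction rule: monomials.induct)
  case base
  then show ?case using v\<^sub>0_weight below_zero by metis
next
  case (lower u i)
  then obtain b where "u \<in> weight_vectors (below b)" by blast
  from act_f_weight[OF this lower.hyps(2)] show ?case
    using below_add_at[OF lower.hyps(2), of b 1]
    by (intro exI[of _ "b(i := b i + 1)"]) (simp del: fun_upd_apply)
qed

lemma act_span_monomials:
  assumes "\<And>u. u \<in> monomials \<Longrightarrow> act x u \<in> V.span monomials" and "w \<in> V.span monomials"
  shows "act x w \<in> V.span monomials"
  using assms(2)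
proof (induction rule: V.span_induct_alt)
  case base
  then show ?case by (simp add: V.span_zero)
next
  case (step c u w)
  then show ?case by (simp add: act_add act_scale V.span_add V.span_scale assms(1))
qed

lemma act_h_span: "w \<in> V.span monomials \<Longrightarrow> act (\<iota> h) w \<in> V.span monomials"
proof (rule act_span_monomials)
  fix u assume u: "u \<in> monomials"
  then obtain b where "u \<in> weight_vectors (below b)" using monomial_weight by blast
  then show "act (\<iota> h) u \<in> V.span monomials"
    using u by (simp add: weight_vectors_iff V.span_base V.span_scale)
qed

lemma act_f_span: "i < n \<Longrightarrow> w \<in> V.span monomials \<Longrightarrow> act (f i) w \<in> V.span monomials"
  by (rule act_span_monomials) (auto intro: V.span_base monomials.lower)

text \<open>Moving \<open>e\<^sub>j\<close> to the right through a product of \<open>f\<^sub>i\<close> produces only terms in which one factor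
  is replaced by an element of \<open>\<hh>\<close>, until \<open>e\<^sub>j\<close> kills the highest weight vector.\<close>
lemma act_e_span: "j < n \<Longrightarrow> w \<in> V.span monomials \<Longrightarrow> act (e j) w \<in> V.span monomials"
proof (rule act_span_monomials)
  fix u assume j: "j < n" and "u \<in> monomials"
  from this(2) show "act (e j) u \<in> V.span monomials"
  proof (induction rule: monomials.induct)
    case base
    then show ?case using j by (simp add: act_e_v\<^sub>0 V.span_zero)
  next
    case (lower u i)
    have "act (e j) (act (f i) u) = act (bracket (e j) (f i)) u + act (f i) (act (e j) u)"
      by (simp add: act_bracket)
    then show ?case
      using lower j
      by (auto simp: bracket_e_f intro!: V.span_add act_f_span act_h_span intro: V.span_base)
  qed
qed

text \<open>The elements of the Lie algebra that preserve a subspace form a subalgebra, so preservation needs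
  checking on generators only.\<close>
lemma span_monomials: "V.span monomials = UNIV"
proof (rule v\<^sub>0_generates)
  define S where "S = {x. \<forall>w\<in>V.span monomials. act x w \<in> V.span monomials}"
  have "lie_subalgebra scaleG bracket S"
    unfolding lie_subalgebra_def S_def
    by (auto simp: G.subspace_def act_add_left act_scale_left act_bracket
        V.span_add V.span_scale V.span_diff V.span_zero)
  moreover have "range \<iota> \<union> e ` {..<n} \<union> f ` {..<n} \<subseteq> S"
    by (auto simp: S_def act_h_span act_e_span act_f_span)
  ultimately have "S = UNIV"
    using generated unfolding lie_generated_def by blast
  then show "submodule scaleV act (V.span monomials)"
    unfolding submodule_def by (auto simp: S_def)
qed (simp add: V.span_base monomials.base)

text \<open>A vector is a combination of monomials, whose weights all have the form \<open>below b\<close>; it cannot have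
  any other weight since different weights are independent.\<close>
theorem weight_below:
  assumes "weight_vectors \<mu> \<noteq> {0}"
  shows "\<exists>b. \<mu> = below b"
proof (rule ccontr)
  assume not_below: "\<nexists>b. \<mu> = below b"
  have "0 \<in> weight_vectors \<mu>" by (simp add: weight_vectors_iff)
  then obtain u where u: "u \<in> weight_vectors \<mu>" "u \<noteq> 0" using assms by blast
  have "u \<in> V.span monomials" by (simp add: span_monomials)
  then obtain T r where T: "finite T" "T \<subseteq> monomials" "u = (\<Sum>w\<in>T. scaleV (r w) w)"
    by (auto simp: V.span_explicit)
  have "\<forall>w\<in>T. \<exists>b. w \<in> weight_vectors (below b)" using T(2) monomial_weight by blast
  then obtain b where b: "w \<in> weight_vectors (below (b w))" if "w \<in> T" for w by metis
  have "(\<Sum>w\<in>T. scaleV (r w) w) = 0"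
  proof (rule weight_vector_eq_sum_imp_zero[OF T(1)])
    show "scaleV (r w) w \<in> weight_vectors (below (b w))" if "w \<in> T" for w
      using b[OF that] by (simp add: weight_vectors_iff act_scale V.scale_left_commute)
    show "below (b w) \<noteq> \<mu>" for w using not_below by metis
    show "(\<Sum>w\<in>T. scaleV (r w) w) \<in> weight_vectors \<mu>" using u T by simp
  qed
  then show False using u T by simp
qed

lemma roots_linearly_independent:
  assumes "(\<lambda>h. \<Sum>i<n. c i * \<alpha> i h) = (\<lambda>h. 0)" "i < n"
  shows "c i = 0"
proof -
  interpret F: vector_space "fun_scale :: complex \<Rightarrow> ('h \<Rightarrow> complex) \<Rightarrow> _"
    by unfold_locales (auto simp: fun_scale_def algebra_simps)
  have sum_apply: "(\<Sum>a\<in>I. g a) h = (\<Sum>a\<in>I. g a h)" for I :: "nat set" and g :: "nat \<Rightarrow> 'h \<Rightarrow> complex" and h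
    by (induction I rule: infinite_finite_induct) auto
  have "(\<Sum>a\<in>\<alpha> ` {..<n}. fun_scale (c (the_inv_into {..<n} \<alpha> a)) a)
      = (\<Sum>i<n. fun_scale (c i) (\<alpha> i))"
    using inj_root by (subst sum.reindex) (auto simp: the_inv_into_f_f)
  also have "\<dots> = 0" using assms(1) by (simp add: fun_eq_iff sum_apply fun_scale_def)
  finally have "c (the_inv_into {..<n} \<alpha> (\<alpha> i)) = 0"
    using indep_root assms(2)
    by (intro F.independentD[where s = "\<alpha> ` {..<n}" and t = "\<alpha> ` {..<n}"
          and u = "\<lambda>a. c (the_inv_into {..<n} \<alpha> a)"]) auto
  then show ?thesis using inj_root assms(2) by (simp add: the_inv_into_f_f)
qed

lemma below_eq_iff: "below b = below b' \<longleftrightarrow> (\<forall>i<n. b i = b' i)"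
proof
  assume eq: "below b = below b'"
  have "(\<lambda>h. \<Sum>i<n. (of_nat (b i) - of_nat (b' i)) * \<alpha> i h) = (\<lambda>h. 0)"
    using fun_cong[OF eq] by (simp add: below_def left_diff_distrib sum_subtractf)
  from roots_linearly_independent[OF this] show "\<forall>i<n. b i = b' i" by simp
qed (auto simp: below_def intro!: sum.cong)

lemma below_coroot:
  assumes "i < n"
  shows "below b (\<alpha>c i) = \<Lambda> (\<alpha>c i) - of_int (\<Sum>j<n. int (b j) * A i j)"
  using assms by (simp add: below_def root_coroot)

lemma below_dual: "below b \<in> dual_space scaleH"
proof -
  have [simp]: "\<Lambda> (x + y) = \<Lambda> x + \<Lambda> y" "\<Lambda> (scaleH c x) = c * \<Lambda> x" for x y c
    using \<Lambda>_dual by (auto simp: dual_space_def Vector_Spaces.linear_iff)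
  have [simp]: "\<alpha> i (x + y) = \<alpha> i x + \<alpha> i y" "\<alpha> i (scaleH c x) = c * \<alpha> i x" if "i < n" for i x y c
    using root_dual[OF that] by (auto simp: dual_space_def Vector_Spaces.linear_iff)
  have "vector_space ((*) :: complex \<Rightarrow> complex \<Rightarrow> complex)"
    by unfold_locales (auto simp: algebra_simps)
  then show ?thesis
    using H.vector_space_axioms
    by (auto simp: dual_space_def Vector_Spaces.linear_iff below_def algebra_simps sum.distrib sum_distrib_left)
qed

text \<open>Raising more than \<open>b i\<close> times in the direction \<open>\<alpha> i\<close> leaves the cone below \<open>\<Lambda>\<close>, and so
  the set of weights.\<close>
lemma raising_nilpotent:
  assumes "u \<in> weight_vectors \<mu>" "i < n"
  shows "\<exists>r. (act (e i) ^^ r) u = 0"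
proof (rule ccontr)
  assume nz: "\<nexists>r. (act (e i) ^^ r) u = 0"
  have w: "(act (e i) ^^ r) u \<in> weight_vectors (\<lambda>h. \<mu> h + of_nat r * \<alpha> i h)" for r
  proof (induction r)
    case (Suc r)
    from act_e_weight[OF Suc assms(2)] show ?case by (simp add: algebra_simps)
  qed (use assms in simp)
  have b: "\<exists>b. (\<lambda>h. \<mu> h + of_nat r * \<alpha> i h) = below b" for r
    using w[of r] nz by (intro weight_below) auto
  obtain b where b0: "\<mu> = below b" using b[of 0] by auto
  obtain b' where "(\<lambda>h. below b h + of_nat (Suc (b i)) * \<alpha> i h) = below b'"
    using b[of "Suc (b i)"] b0 by metis
  then have "below b = below (b'(i := b' i + Suc (b i)))"
    unfolding below_add_at[OF assms(2), of b' "Suc (b i)"] by (metis add_diff_cancel_right')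
  then show False using assms(2) unfolding below_eq_iff by force
qed

text \<open>In fact \<open>f\<^sub>i\<close> is injective on such a weight space. A weight vector \<open>u\<close> killed by \<open>f\<^sub>i\<close> would be
  a lowest weight vector for the \<open>\<ss>\<ll>\<^sub>2\<close> spanned by \<open>e\<^sub>i\<close>, \<open>f\<^sub>i\<close> and the coroot, and at positive
  weight \<open>m\<close> it would generate an infinite chain of nonzero vectors under \<open>e\<^sub>i\<close>: applying \<open>f\<^sub>i\<close>
  to the \<open>(r+1)\<close>-st one returns a nonzero multiple, by \<open>- (r + 1) (m + r)\<close>, of the \<open>r\<close>-th one.
  This contradicts \<open>raising_nilpotent\<close>.\<close>
lemma weight_minus_root:
  assumes "weight_vectors \<mu> \<noteq> {0}" "i < n" and A: "A i i = 2"
    and m: "\<mu> (\<alpha>c i) = of_int m" "m > 0"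
  shows "weight_vectors (\<lambda>h. \<mu> h - \<alpha> i h) \<noteq> {0}"
proof -
  have "0 \<in> weight_vectors \<mu>" by (simp add: weight_vectors_iff)
  then obtain u where u: "u \<in> weight_vectors \<mu>" "u \<noteq> 0" using assms by blast
  have "act (f i) u \<noteq> 0"
  proof
    assume fu: "act (f i) u = 0"
    define x where "x r = (act (e i) ^^ r) u" for r
    have x0: "x 0 = u" and xS: "x (Suc r) = act (e i) (x r)" for r by (simp_all add: x_def)
    have xw: "x r \<in> weight_vectors (\<lambda>h. \<mu> h + of_nat r * \<alpha> i h)" for r
    proof (induction r)
      case (Suc r)
      from act_e_weight[OF Suc assms(2)] show ?case by (simp add: xS algebra_simps)
    qed (use u x0 in simp)
    have h_x: "act (\<iota> (\<alpha>c i)) (x r) = scaleV (of_int (m + 2 * int r)) (x r)" for r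
      using xw[of r] root_coroot[OF assms(2,2)] A m by (simp add: weight_vectors_iff mult.commute)
    have f_e: "act (f i) (act (e i) w) = act (e i) (act (f i) w) - act (\<iota> (\<alpha>c i)) w" for w
      using act_bracket[of "e i" "f i" w] assms(2) by (simp add: bracket_e_f)
    have f_x: "act (f i) (x (Suc r)) = scaleV (of_int (- ((int r + 1) * (m + int r)))) (x r)" for r
    proof (induction r)
      case 0
      show ?case unfolding xS f_e h_x by (simp add: x0 fu)
    next
      case (Suc r)
      have c: "- ((int (Suc r) + 1) * (m + int (Suc r)))
          = - ((int r + 1) * (m + int r)) - (m + 2 * int (Suc r))" by (simp add: algebra_simps)
      show ?case
        unfolding xS[of "Suc r"] f_e h_x Suc c
        by (simp only: act_scale xS[symmetric] of_int_diff V.scale_left_diff_distrib)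
    qed
    have "\<exists>r. x r = 0" using raising_nilpotent[OF u(1) assms(2)] by (simp add: x_def)
    moreover have "x r \<noteq> 0" for r
    proof (induction r)
      case (Suc r)
      show ?case
      proof
        assume "x (Suc r) = 0"
        then have "(of_int (- ((int r + 1) * (m + int r))) :: complex) = 0"
          using f_x[of r] Suc by (metis V.scale_eq_0_iff act_zero)
        then have "(int r + 1) * (m + int r) = 0" by (simp only: of_int_eq_0_iff neg_equal_0_iff_equal)
        then show False using m(2) by simp
      qed
    qed (use u x0 in simp)
    ultimately show False by blast
  qed
  then show ?thesis using act_f_weight[OF u(1) assms(2)] by auto
qed

end

section \<open>The affine Cartan matrix as a second difference on a cycle\<close>

text \<open>The product of the affine Cartan matrix with the vector \<open>c\<close>, which is minus the second
  difference of \<open>c\<close> on the cycle \<open>\<int>/p\<int>\<close>.\<close>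
definition cartan_image :: "nat \<Rightarrow> (nat \<Rightarrow> int) \<Rightarrow> nat \<Rightarrow> int" where
  "cartan_image p c i = (\<Sum>j<p. c j * affine_A p i j)"

lemma mod_Suc_eq_iff_pred:
  fixes i j p :: nat
  assumes "i < p" "j < p"
  shows "(j + 1) mod p = i \<longleftrightarrow> j = (i + p - 1) mod p"
proof
  assume "(j + 1) mod p = i"
  then show "j = (i + p - 1) mod p"
    using assms by (cases "Suc j = p") (auto simp: mod_if)
next
  assume "j = (i + p - 1) mod p"
  then show "(j + 1) mod p = i"
    using assms by (cases i) (auto simp: mod_if)
qed

lemma cartan_image_eq:
  assumes "i < p"
  shows "cartan_image p c i = 2 * c i - c ((i + 1) mod p) - c ((i + p - 1) mod p)"
proof -
  have p: "p > 0" using assms by simp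
  have "cartan_image p c i = (\<Sum>j<p. (if i = j then 2 * c j else 0)
      - (if (i + 1) mod p = j then c j else 0) - (if j = (i + p - 1) mod p then c j else 0))"
    unfolding cartan_image_def affine_A_def
    using mod_Suc_eq_iff_pred[OF assms] by (intro sum.cong) (auto simp: algebra_simps)
  also have "\<dots> = 2 * c i - c ((i + 1) mod p) - c ((i + p - 1) mod p)"
    using assms p unfolding sum_subtractf by (simp add: sum.delta sum.delta')
  finally show ?thesis .
qed

lemma sum_cyclic_shift:
  fixes g :: "nat \<Rightarrow> 'a::comm_monoid_add"
  shows "(\<Sum>i<p. g ((i + 1) mod p)) = (\<Sum>i<p. g i)"
proof (cases p)
  case (Suc q)
  have "(\<Sum>i<q. g ((i + 1) mod Suc q)) = (\<Sum>i<q. g (Suc i))" by (intro sum.cong) auto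
  then show ?thesis
    unfolding Suc sum.lessThan_Suc_shift[of g] sum.lessThan_Suc[of "\<lambda>i. g ((i + 1) mod Suc q)"]
    by (simp add: add.commute)
qed simp

lemma sum_cyclic_pred:
  fixes h :: "nat \<Rightarrow> nat \<Rightarrow> 'a::comm_monoid_add"
  shows "(\<Sum>i<p. h i ((i + p - 1) mod p)) = (\<Sum>i<p. h ((i + 1) mod p) i)"
proof -
  have "((i + 1) mod p + p - 1) mod p = i" if "i < p" for i
    using mod_Suc_eq_iff_pred[of "(i + 1) mod p" p i] that by simp
  then show ?thesis
    using sum_cyclic_shift[of "\<lambda>i. h i ((i + p - 1) mod p)" p] by simp
qed

lemma sum_cartan_image: "(\<Sum>i<p. cartan_image p c i) = 0"
proof -
  have "(\<Sum>i<p. cartan_image p c i) = (\<Sum>i<p. 2 * c i - c ((i + 1) mod p) - c ((i + p - 1) mod p))"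
    by (intro sum.cong refl) (simp add: cartan_image_eq)
  also have "\<dots> = 0"
    unfolding sum_subtractf sum_cyclic_shift[of c] sum_cyclic_pred[of "\<lambda>i j. c j"]
    by (simp flip: sum_distrib_left)
  finally show ?thesis .
qed

text \<open>The quadratic form of the affine Cartan matrix is \<open>\<Sum>\<^sub>i (c\<^sub>i - c\<^sub>i\<^sub>+\<^sub>1)\<^sup>2\<close>, which vanishes only on
  constant vectors.\<close>
lemma constant_if_cartan_image_nonpos:
  assumes "\<And>i. i < p \<Longrightarrow> c i * cartan_image p c i \<le> 0" and "i < p"
  shows "c i = c 0"
proof -
  have "(\<Sum>i<p. c i * cartan_image p c i)
      = (\<Sum>i<p. 2 * (c i)\<^sup>2 - c i * c ((i + 1) mod p) - c i * c ((i + p - 1) mod p))"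
    by (intro sum.cong refl) (simp add: cartan_image_eq algebra_simps power2_eq_square)
  also have "\<dots> = (\<Sum>i<p. (c i)\<^sup>2) + (\<Sum>i<p. (c ((i + 1) mod p))\<^sup>2) - 2 * (\<Sum>i<p. c i * c ((i + 1) mod p))"
    unfolding sum_subtractf sum_cyclic_pred[of "\<lambda>i j. c i * c j"] sum_cyclic_shift[of "\<lambda>i. (c i)\<^sup>2"]
    by (simp add: mult.commute flip: sum_distrib_left)
  also have "\<dots> = (\<Sum>i<p. (c i - c ((i + 1) mod p))\<^sup>2)"
    by (simp add: power2_diff sum_subtractf sum.distrib sum_distrib_left mult.assoc)
  finally have "(\<Sum>i<p. (c i - c ((i + 1) mod p))\<^sup>2) \<le> 0"
    using sum_nonpos[of "{..<p}" "\<lambda>i. c i * cartan_image p c i"] assms(1) by simp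
  then have "(\<Sum>i<p. (c i - c ((i + 1) mod p))\<^sup>2) = 0"
    by (intro antisym sum_nonneg) auto
  then have "\<forall>i\<in>{..<p}. (c i - c ((i + 1) mod p))\<^sup>2 = 0"
    by (simp only: sum_nonneg_eq_0_iff finite_lessThan zero_le_power2)
  then have step: "c ((i + 1) mod p) = c i" if "i < p" for i
    using that by (metis eq_iff_diff_eq_0 lessThan_iff zero_eq_power2)
  show ?thesis using assms(2)
  proof (induction i)
    case (Suc i)
    then have "c (Suc i) = c i" using step[of i] by (simp only: Suc_eq_plus1 mod_less)
    also have "\<dots> = c 0" using Suc by (simp only: Suc_lessD)
    finally show ?case .
  qed simp
qed

lemma cartan_image_diff:
  "cartan_image p (\<lambda>j. c j - c' j) i = cartan_image p c i - cartan_image p c' i"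
  by (simp add: cartan_image_def left_diff_distrib sum_subtractf)

lemma cartan_image_const: "i < p \<Longrightarrow> cartan_image p (\<lambda>_. t) i = 0"
  by (simp add: cartan_image_eq)

lemma cartan_image_cong:
  "(\<And>j. j < p \<Longrightarrow> c j = c' j) \<Longrightarrow> cartan_image p c i = cartan_image p c' i"
  by (simp add: cartan_image_def)

text \<open>Summation by parts moves the second difference to the weights \<open>0, \<dots>, p - 1\<close>. These are linear
  on the cycle except for a jump by \<open>p\<close> where it closes.\<close>
lemma dvd_weighted_sum_cartan_image:
  "int p dvd (\<Sum>i<p. int i * cartan_image p c i)"
proof -
  have "(\<Sum>i<p. int i * cartan_image p c i)
      = (\<Sum>i<p. 2 * int i * c i - int i * c ((i + 1) mod p) - int i * c ((i + p - 1) mod p))"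
    by (intro sum.cong refl) (simp add: cartan_image_eq algebra_simps)
  also have "\<dots> = (\<Sum>i<p. 2 * int i * c i) - (\<Sum>i<p. int i * c ((i + 1) mod p))
      - (\<Sum>i<p. int ((i + 1) mod p) * c i)"
    unfolding sum_subtractf sum_cyclic_pred[of "\<lambda>i j. int i * c j"] ..
  also have "(\<Sum>i<p. 2 * int i * c i)
      = (\<Sum>i<p. int i * c i) + (\<Sum>i<p. int ((i + 1) mod p) * c ((i + 1) mod p))"
    unfolding sum_cyclic_shift[of "\<lambda>i. int i * c i"]
    by (simp add: mult.assoc flip: sum_distrib_left)
  also have "\<dots> - (\<Sum>i<p. int i * c ((i + 1) mod p)) - (\<Sum>i<p. int ((i + 1) mod p) * c i)
      = (\<Sum>i<p. (int ((i + 1) mod p) - int i) * (c ((i + 1) mod p) - c i))"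
    by (simp add: algebra_simps sum.distrib sum_subtractf)
  also have "\<dots> = (\<Sum>i<p. (int ((i + 1) mod p) - int i - 1) * (c ((i + 1) mod p) - c i))"
    by (simp add: left_diff_distrib sum_subtractf sum_cyclic_shift[of c, simplified])
  also have "int p dvd \<dots>"
  proof (intro dvd_sum dvd_mult2)
    fix i
    have "int ((i + 1) mod p) = (int i + 1) mod int p" by (simp add: zmod_int add.commute)
    then have "int ((i + 1) mod p) - int i - 1 = (int i + 1) mod int p - (int i + 1)" by simp
    then show "int p dvd int ((i + 1) mod p) - int i - 1"
      by (metis dvd_minus_mod minus_diff_eq dvd_minus_iff)
  qed
  finally show ?thesis .
qed

section \<open>Reduced admissible vectors and compositions\<close>

text \<open>Dominance of \<open>k\<Lambda>\<^sub>0 - \<Sum>\<^sub>j b\<^sub>j \<alpha>\<^sub>j\<close>, expressed through its values on the simple coroots.\<close>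
definition admissible :: "nat \<Rightarrow> nat \<Rightarrow> (nat \<Rightarrow> nat) \<Rightarrow> bool" where
  "admissible k p b \<longleftrightarrow> (\<forall>i<p. cartan_image p (\<lambda>j. int (b j)) i \<le> (if i = 0 then int k else 0))"

text \<open>One representative \<open>b\<close> for each dominant maximal weight. Fixing the entries from
  \<open>p\<close> on makes the representative unique.\<close>
definition reduced_admissible :: "nat \<Rightarrow> nat \<Rightarrow> (nat \<Rightarrow> nat) set" where
  "reduced_admissible k p = {b. (\<forall>i\<ge>p. b i = 0) \<and> admissible k p b \<and> (\<exists>i<p. b i = 0)}"

text \<open>The cokernel of the affine Cartan matrix is detected by the sum of the entries and by the weighted
  sum modulo \<open>p\<close>. The vector \<open>c\<close> is obtained by summing \<open>v\<close> twice along the cycle. The first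
  summation has a free constant; the value \<open>s - k\<close>, with \<open>p s\<close> the weighted sum of \<open>v\<close>, makes
  the second summation close up, \<open>N p = N 0\<close>.\<close>
lemma cartan_image_surj:
  fixes v :: "nat \<Rightarrow> int"
  assumes "p > 0" "(\<Sum>i<p. v i) = k" "int p dvd (\<Sum>i<p. int i * v i)"
  shows "\<exists>c. \<forall>i<p. cartan_image p c i = (if i = 0 then k else 0) - v i"
proof -
  from assms(3) obtain s where s: "(\<Sum>i<p. int i * v i) = int p * s" by (elim dvdE)
  define D where "D i = s - k + (\<Sum>l<Suc i. v l)" for i
  define N where "N j = (\<Sum>i<j. D i)" for j
  have N_eq: "N j = int j * (s - k) + (\<Sum>l<j. (int j - int l) * v l)" for j
  proof (induction j)
    case 0
    show ?case by (simp add: N_def)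
  next
    case (Suc j)
    have "(\<Sum>l<Suc j. (int (Suc j) - int l) * v l)
        = (\<Sum>l<Suc j. (int j - int l) * v l) + (\<Sum>l<Suc j. v l)"
      unfolding sum.distrib[symmetric] by (intro sum.cong) (auto simp: algebra_simps)
    then show ?case using Suc by (simp add: N_def D_def algebra_simps)
  qed
  have Np: "N p = 0"
    using assms(2) s unfolding N_eq left_diff_distrib sum_subtractf
    by (simp add: algebra_simps flip: sum_distrib_left)
  have Dp: "D (p - 1) = s" using assms(1,2) by (simp add: D_def)
  have NS: "N (Suc j) = N j + D j" for j by (simp add: N_def)
  have N0: "N 0 = 0" by (simp add: N_def)
  have Nsucc: "N ((i + 1) mod p) = N i + D i" if "i < p" for i
    using that Np N0 NS[of i] by (cases "Suc i = p") auto
  have "cartan_image p N i = (if i = 0 then k else 0) - v i" if i: "i < p" for i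
  proof (cases i)
    case 0
    have "N p = N (p - 1) + D (p - 1)" using NS[of "p - 1"] assms(1) by simp
    then show ?thesis
      unfolding cartan_image_eq[OF i] Nsucc[OF i] using 0 Np Dp N0 assms(1)
      by (simp add: D_def)
  next
    case (Suc j)
    have "(i + p - 1) mod p = j" using Suc i by simp
    then show ?thesis
      unfolding cartan_image_eq[OF i] Nsucc[OF i] using Suc NS[of j] by (simp add: D_def)
  qed
  then show ?thesis by blast
qed

text \<open>The two vectors differ by a constant, since their difference is in the kernel of the Cartan matrix,
  and both have minimum \<open>0\<close>.\<close>
lemma reduced_admissible_eqI:
  assumes b: "b \<in> reduced_admissible k p" and b': "b' \<in> reduced_admissible k p"
    and eq: "\<And>i. i < p \<Longrightarrow> cartan_image p (\<lambda>j. int (b j)) i = cartan_image p (\<lambda>j. int (b' j)) i"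
  shows "b = b'"
proof -
  define c where "c j = int (b j) - int (b' j)" for j
  have "cartan_image p c i = 0" if "i < p" for i
    using eq[OF that] unfolding c_def cartan_image_diff by simp
  then have const: "c i = c 0" if "i < p" for i
    using that by (intro constant_if_cartan_image_nonpos[of p c]) auto
  obtain i j where ij: "i < p" "b i = 0" "j < p" "b' j = 0"
    using b b' by (auto simp: reduced_admissible_def)
  have "c 0 = 0" using const[OF ij(1)] const[OF ij(3)] ij(2,4) by (simp add: c_def)
  then have "b i = b' i" if "i < p" for i using const[OF that] by (simp add: c_def)
  moreover have "b i = b' i" if "i \<ge> p" for i using b b' that by (simp add: reduced_admissible_def)
  ultimately show "b = b'" by (metis ext not_le)
qed

text \<open>The value of \<open>k\<Lambda>\<^sub>0 - \<Sum>\<^sub>j b\<^sub>j \<alpha>\<^sub>j\<close> on the \<open>i\<close>-th simple coroot.\<close>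
definition label :: "nat \<Rightarrow> nat \<Rightarrow> (nat \<Rightarrow> nat) \<Rightarrow> nat \<Rightarrow> int" where
  "label k p b i = (if i = 0 then int k else 0) - cartan_image p (\<lambda>j. int (b j)) i"

lemma labels_in_natpermute:
  assumes b: "admissible k p b" and p: "p > 0"
  shows "map (\<lambda>i. nat (label k p b i)) [0..<p] \<in> {v \<in> natpermute k p. p dvd (\<Sum>j<p. j * v ! j)}"
proof -
  define v where "v = map (\<lambda>i. nat (label k p b i)) [0..<p]"
  have nth: "int (v ! i) = label k p b i" if "i < p" for i
    using b that unfolding admissible_def label_def v_def by auto
  have len: "length v = p" by (simp add: v_def)
  have "int (sum_list v) = (\<Sum>i<p. int (v ! i))"
    by (simp add: sum_list_sum_nth len lessThan_atLeast0)
  also have "\<dots> = (\<Sum>i<p. label k p b i)"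
    by (intro sum.cong refl) (simp add: nth)
  also have "\<dots> = int k"
    using p unfolding label_def sum_subtractf sum_cartan_image by simp
  finally have "sum_list v = k" by (simp only: of_nat_eq_iff)
  moreover have "int (\<Sum>j<p. j * v ! j) = - (\<Sum>j<p. int j * cartan_image p (\<lambda>j. int (b j)) j)"
    unfolding of_nat_sum sum_negf[symmetric] by (intro sum.cong refl) (simp add: nth label_def)
  then have "int p dvd int (\<Sum>j<p. j * v ! j)"
    using dvd_weighted_sum_cartan_image[of p] by (simp only: dvd_minus_iff)
  then have "p dvd (\<Sum>j<p. j * v ! j)" by (simp only: of_nat_dvd_iff)
  ultimately show ?thesis using len unfolding v_def[symmetric] by (simp add: natpermute_def)
qed

text \<open>A preimage under the Cartan matrix is shifted by a constant to have minimum \<open>0\<close>.\<close>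
lemma natpermute_is_labels:
  assumes v: "v \<in> natpermute k p" and dvd: "p dvd (\<Sum>j<p. j * v ! j)" and p: "p > 0"
  shows "\<exists>b\<in>reduced_admissible k p. \<forall>i<p. label k p b i = int (v ! i)"
proof -
  have len: "length v = p" and sum: "sum_list v = k"
    using v by (auto simp: natpermute_def)
  have "(\<Sum>i<p. int (v ! i)) = int k"
    using sum by (simp add: sum_list_sum_nth len lessThan_atLeast0 flip: of_nat_sum)
  moreover have "int p dvd (\<Sum>i<p. int i * int (v ! i))"
    using dvd by (simp flip: of_nat_mult of_nat_sum)
  ultimately obtain c where c: "cartan_image p c i = (if i = 0 then int k else 0) - int (v ! i)"
    if "i < p" for i using cartan_image_surj[OF p, of "\<lambda>i. int (v ! i)" "int k"] by blast
  define t where "t = Min (c ` {..<p})"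
  have t_le: "t \<le> c i" if "i < p" for i using that by (auto simp: t_def)
  have "t \<in> c ` {..<p}" unfolding t_def using p by (intro Min_in) auto
  then obtain i0 where i0: "i0 < p" "c i0 = t" by auto
  define b where "b i = (if i < p then nat (c i - t) else 0)" for i
  have L: "cartan_image p (\<lambda>j. int (b j)) i = (if i = 0 then int k else 0) - int (v ! i)"
    if "i < p" for i
  proof -
    have "cartan_image p (\<lambda>j. int (b j)) i = cartan_image p (\<lambda>j. c j - t) i"
      using t_le by (intro cartan_image_cong) (simp add: b_def)
    then show ?thesis using that by (simp add: cartan_image_diff cartan_image_const c)
  qed
  have "b i0 = 0" using i0 by (simp add: b_def)
  moreover have "\<forall>i\<ge>p. b i = 0" by (simp add: b_def)
  moreover have "admissible k p b" unfolding admissible_def by (simp add: L)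
  ultimately have "b \<in> reduced_admissible k p" using i0(1) unfolding reduced_admissible_def by blast
  then show ?thesis using L by (intro bexI[of _ b]) (simp_all add: label_def)
qed

lemma card_reduced_admissible:
  assumes p: "p > 0"
  shows "card (reduced_admissible k p) = card {v \<in> natpermute k p. p dvd (\<Sum>j<p. j * v ! j)}"
    (is "_ = card ?M")
proof -
  define \<Phi> where "\<Phi> b = map (\<lambda>i. nat (label k p b i)) [0..<p]" for b
  have "inj_on \<Phi> (reduced_admissible k p)"
  proof (rule inj_onI)
    fix b b' assume b: "b \<in> reduced_admissible k p" and b': "b' \<in> reduced_admissible k p"
      and eq: "\<Phi> b = \<Phi> b'"
    show "b = b'"
    proof (rule reduced_admissible_eqI[OF b b'])
      fix i assume i: "i < p"
      have "\<Phi> b ! i = \<Phi> b' ! i" by (simp only: eq)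
      then have "nat (label k p b i) = nat (label k p b' i)" using i by (simp add: \<Phi>_def)
      moreover have "label k p b i \<ge> 0" "label k p b' i \<ge> 0"
        using b b' i unfolding reduced_admissible_def admissible_def label_def by auto
      ultimately have "label k p b i = label k p b' i" by (simp only: eq_nat_nat_iff)
      then show "cartan_image p (\<lambda>j. int (b j)) i = cartan_image p (\<lambda>j. int (b' j)) i"
        by (simp add: label_def)
    qed
  qed
  moreover have "\<Phi> ` reduced_admissible k p = ?M"
  proof (intro subset_antisym subsetI)
    fix v assume "v \<in> \<Phi> ` reduced_admissible k p"
    then obtain b where "admissible k p b" "v = \<Phi> b" unfolding reduced_admissible_def by blast
    then show "v \<in> ?M" using labels_in_natpermute[OF _ p] unfolding \<Phi>_def by blast
  next
    fix v assume v: "v \<in> ?M"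
    then obtain b where b: "b \<in> reduced_admissible k p" "\<forall>i<p. label k p b i = int (v ! i)"
      using natpermute_is_labels[OF _ _ p] by blast
    have "v = \<Phi> b"
      using v b(2) unfolding natpermute_def \<Phi>_def by (intro nth_equalityI) auto
    then show "v \<in> \<Phi> ` reduced_admissible k p" using b(1) by blast
  qed
  ultimately show ?thesis by (metis card_image)
qed

section \<open>Dominant maximal weights for affine type \<open>A\<close>\<close>

lemma of_int_in_Nats_iff: "(of_int z :: complex) \<in> \<nat> \<longleftrightarrow> z \<ge> 0"
proof
  assume "(of_int z :: complex) \<in> \<nat>"
  then obtain m where "(of_int z :: complex) = of_int (int m)" by (auto elim: Nats_cases)
  then show "z \<ge> 0" by (simp only: of_int_eq_iff)
next
  assume "z \<ge> 0"
  then show "(of_int z :: complex) \<in> \<nat>" by (metis of_int_of_nat_eq of_nat_in_Nats zero_le_imp_eq_int)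
qed

text \<open>The level \<open>k\<close> has to be positive: at level \<open>0\<close> the null root itself can separate \<open>\<Lambda>\<close> from a
  dominant functional, and the trivial module has \<open>\<Lambda>\<close> as its only weight.\<close>
locale affine_A_highest_weight_module =
  highest_weight_module scaleH p "affine_A p" \<alpha>c \<alpha> scaleG bracket \<iota> e f scaleV act \<Lambda> v\<^sub>0
  for scaleH :: "complex \<Rightarrow> 'h::ab_group_add \<Rightarrow> 'h"
    and p :: nat
    and \<alpha>c :: "nat \<Rightarrow> 'h"
    and \<alpha> :: "nat \<Rightarrow> 'h \<Rightarrow> complex"
    and scaleG :: "complex \<Rightarrow> 'g::ab_group_add \<Rightarrow> 'g"
    and bracket :: "'g \<Rightarrow> 'g \<Rightarrow> 'g"
    and \<iota> :: "'h \<Rightarrow> 'g"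
    and e f :: "nat \<Rightarrow> 'g"
    and scaleV :: "complex \<Rightarrow> 'v::ab_group_add \<Rightarrow> 'v"
    and act :: "'g \<Rightarrow> 'v \<Rightarrow> 'v"
    and \<Lambda> :: "'h \<Rightarrow> complex" and v\<^sub>0 :: 'v +
  fixes k :: nat
  assumes k_pos: "k \<ge> 1" and p_ge_2: "p \<ge> 2"
    and \<Lambda>_coroot: "i < p \<Longrightarrow> \<Lambda> (\<alpha>c i) = (if i = 0 then of_nat k else 0)"
begin

lemma below_label: "i < p \<Longrightarrow> below b (\<alpha>c i) = of_int (label k p b i)"
  by (simp add: below_coroot \<Lambda>_coroot label_def cartan_image_def)

lemma below_dominant_iff:
  "below b \<in> dominant_integral_weights scaleH p \<alpha>c \<longleftrightarrow> admissible k p b"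
proof -
  have "below b \<in> dominant_integral_weights scaleH p \<alpha>c \<longleftrightarrow> (\<forall>i<p. label k p b i \<ge> 0)"
    by (simp add: dominant_integral_weights_def below_dual below_label of_int_in_Nats_iff)
  then show ?thesis by (simp add: label_def admissible_def)
qed

lemma affine_A_diagonal: "i < p \<Longrightarrow> affine_A p i i = 2"
  using p_ge_2 by (auto simp: affine_A_def mod_if)

text \<open>Among the weights \<open>below b'\<close> with \<open>b' \<le> b\<close>, choose one with \<open>b'\<close> of maximal sum, and let
  \<open>c = b - b'\<close>. No further step towards \<open>b\<close> stays inside the set of weights, so
  \<open>weight_minus_root\<close> makes the label of \<open>b'\<close> nonpositive wherever \<open>c > 0\<close>; as the labels of
  \<open>b\<close> are nonnegative, the Cartan matrix maps \<open>c\<close> to something nonpositive there. Hence \<open>c\<close> is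
  constant. If the constant were positive, all labels of \<open>b'\<close> would be nonpositive, although their
  sum is the level \<open>k\<close>.\<close>
lemma dominant_below_is_weight:
  assumes "admissible k p b"
  shows "weight_vectors (below b) \<noteq> {0}"
proof -
  define S where "S = {b'. (\<forall>i<p. b' i \<le> b i) \<and> weight_vectors (below b') \<noteq> {0}}"
  have zero: "(\<lambda>_. 0) \<in> S"
    using v\<^sub>0_weight v\<^sub>0_nonzero by (auto simp: S_def below_zero)
  have bound: "\<forall>b'. b' \<in> S \<longrightarrow> (\<Sum>i<p. b' i) < Suc (\<Sum>i<p. b i)"
    by (auto simp: S_def less_Suc_eq_le intro: sum_mono)
  have "\<exists>b'. b' \<in> S \<and> (\<forall>b''. b'' \<in> S \<longrightarrow> (\<Sum>i<p. b'' i) \<le> (\<Sum>i<p. b' i))"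
    using zero bound by (rule ex_has_greatest_nat[where P = "\<lambda>b. b \<in> S" and f = "\<lambda>b. \<Sum>i<p. b i"])
  then obtain b' where b': "b' \<in> S"
    and max: "\<And>b''. b'' \<in> S \<Longrightarrow> (\<Sum>i<p. b'' i) \<le> (\<Sum>i<p. b' i)" by blast
  define c where "c i = int (b i) - int (b' i)" for i
  have c_nonneg: "c i \<ge> 0" if "i < p" for i using b' that by (simp add: S_def c_def)
  have label_nonpos: "label k p b' i \<le> 0" if i: "i < p" and ci: "c i > 0" for i
  proof (rule ccontr)
    assume "\<not> label k p b' i \<le> 0"
    then have "weight_vectors (\<lambda>h. below b' h - \<alpha> i h) \<noteq> {0}"
      using b' i by (intro weight_minus_root[where m = "label k p b' i"])
        (auto simp: S_def below_label affine_A_diagonal)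
    then have "b'(i := b' i + 1) \<in> S"
      using b' i ci below_add_at[OF i, of b' 1] by (auto simp: S_def c_def)
    from max[OF this] have "(\<Sum>j<p. (b'(i := b' i + 1)) j) \<le> (\<Sum>j<p. b' j)" .
    moreover have "(\<Sum>j<p. b' j) < (\<Sum>j<p. (b'(i := b' i + 1)) j)"
      using i by (intro sum_strict_mono_ex1) auto
    ultimately show False by simp
  qed
  have label_b: "label k p b i \<ge> 0" if "i < p" for i
    using assms that by (auto simp: admissible_def label_def)
  have c_label: "cartan_image p c i = label k p b' i - label k p b i" for i
    unfolding c_def cartan_image_diff label_def by simp
  have const: "c i = c 0" if "i < p" for i
  proof (rule constant_if_cartan_image_nonpos[OF _ that])
    fix j assume j: "j < p"
    show "c j * cartan_image p c j \<le> 0"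
    proof (cases "c j = 0")
      case False
      then have "cartan_image p c j \<le> 0"
        using label_nonpos[OF j] label_b[OF j] c_nonneg[OF j] c_label[of j] by simp
      then show ?thesis using c_nonneg[OF j] by (simp add: mult_nonneg_nonpos)
    qed simp
  qed
  have "c 0 = 0"
  proof (rule ccontr)
    assume "c 0 \<noteq> 0"
    then have "c i > 0" if "i < p" for i
      using const[OF that] c_nonneg[OF that] by simp
    then have "(\<Sum>i<p. label k p b' i) \<le> 0"
      by (intro sum_nonpos) (auto intro: label_nonpos)
    moreover have "(\<Sum>i<p. label k p b' i) = int k"
      using p_ge_2 unfolding label_def sum_subtractf sum_cartan_image by simp
    ultimately show False using k_pos by simp
  qed
  then have "\<forall>i<p. b i = b' i" using const by (auto simp: c_def)
  then have "below b = below b'" by (simp only: below_eq_iff)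
  then show ?thesis using b' by (simp add: S_def)
qed

lemma below_Suc: "below (\<lambda>i. Suc (b i)) + null_root p \<alpha> = below b"
proof
  fix h
  have "null_root p \<alpha> h = (\<Sum>i<p. \<alpha> i h)"
    unfolding null_root_def by (induction p) auto
  then show "(below (\<lambda>i. Suc (b i)) + null_root p \<alpha>) h = below b h"
    by (simp add: below_def distrib_right sum.distrib)
qed

text \<open>A dominant weight \<open>below b\<close> fails to be maximal exactly if all \<open>b i\<close> with \<open>i < p\<close> are positive:
  lowering them all by one keeps the labels, and so yields again a dominant functional below
  \<open>\<Lambda>\<close>, which is a weight.\<close>
theorem dominant_maximal_weights:
  "maximal_weights (weights scaleH scaleV act \<iota>) (null_root p \<alpha>) \<inter> dominant_integral_weights scaleH p \<alpha>c
     = below ` reduced_admissible k p" (is "?L = _")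
proof (intro subset_antisym subsetI)
  fix \<mu> assume \<mu>: "\<mu> \<in> ?L"
  then have wt: "weight_vectors \<mu> \<noteq> {0}" and dom: "\<mu> \<in> dominant_integral_weights scaleH p \<alpha>c"
    and max: "\<mu> + null_root p \<alpha> \<notin> weights scaleH scaleV act \<iota>"
    by (auto simp: maximal_weights_def weights_def)
  obtain b' where "\<mu> = below b'" using weight_below[OF wt] by blast
  define b where "b i = (if i < p then b' i else 0)" for i
  have \<mu>b: "\<mu> = below b" using \<open>\<mu> = below b'\<close> by (simp add: below_eq_iff b_def)
  have adm: "admissible k p b" using dom by (simp add: \<mu>b below_dominant_iff)
  have "\<exists>i<p. b i = 0"
  proof (rule ccontr)
    assume "\<not> (\<exists>i<p. b i = 0)"
    then have b_pos: "b i = Suc (b i - 1)" if "i < p" for i using that by auto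
    define b'' where "b'' i = b i - 1" for i
    have "below b = below (\<lambda>i. Suc (b'' i))"
      using b_pos by (simp add: below_eq_iff b''_def)
    then have shift: "\<mu> + null_root p \<alpha> = below b''" by (simp add: \<mu>b below_Suc)
    have "cartan_image p (\<lambda>j. int (b'' j)) i = cartan_image p (\<lambda>j. int (b j)) i" if "i < p" for i
    proof -
      have "cartan_image p (\<lambda>j. int (b'' j)) i = cartan_image p (\<lambda>j. int (b j) - 1) i"
        by (rule cartan_image_cong) (use b_pos in \<open>force simp: b''_def\<close>)
      then show ?thesis using that by (simp add: cartan_image_diff cartan_image_const)
    qed
    then have "admissible k p b''" using adm by (simp add: admissible_def)
    then show False
      using max dominant_below_is_weight by (simp add: shift weights_def below_dual)
  qed
  then show "\<mu> \<in> below ` reduced_admissible k p"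
    using adm \<mu>b by (auto simp: reduced_admissible_def b_def)
next
  fix \<mu> assume "\<mu> \<in> below ` reduced_admissible k p"
  then obtain b where b: "b \<in> reduced_admissible k p" and \<mu>: "\<mu> = below b" by blast
  have adm: "admissible k p b" using b by (simp add: reduced_admissible_def)
  have "\<mu> + null_root p \<alpha> \<notin> weights scaleH scaleV act \<iota>"
  proof
    assume "\<mu> + null_root p \<alpha> \<in> weights scaleH scaleV act \<iota>"
    then obtain b' where "\<mu> + null_root p \<alpha> = below b'"
      using weight_below by (auto simp: weights_def)
    then have "\<mu> + null_root p \<alpha> = below (\<lambda>i. Suc (b' i)) + null_root p \<alpha>"
      by (simp only: below_Suc)
    then have "below b = below (\<lambda>i. Suc (b' i))" by (simp add: \<mu>)
    then show False using b by (auto simp: below_eq_iff reduced_admissible_def)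
  qed
  then show "\<mu> \<in> ?L"
    using adm by (simp add: \<mu> maximal_weights_def weights_def below_dual dominant_below_is_weight
        below_dominant_iff)
qed

lemma inj_on_below: "inj_on below (reduced_admissible k p)"
proof (rule inj_onI)
  fix b b' assume b: "b \<in> reduced_admissible k p" "b' \<in> reduced_admissible k p"
    and "below b = below b'"
  then have "\<forall>i<p. b i = b' i" by (simp only: below_eq_iff)
  moreover have "\<forall>i\<ge>p. b i = b' i" using b by (simp add: reduced_admissible_def)
  ultimately show "b = b'" by (metis ext not_le)
qed

end

section \<open>The number of dominant maximal weights\<close>

theorem proposition4p1:
  fixes k p :: nat
    and scaleH :: "complex \<Rightarrow> 'h::ab_group_add \<Rightarrow> 'h"
    and scaleG :: "complex \<Rightarrow> 'g::ab_group_add \<Rightarrow> 'g"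
    and scaleV :: "complex \<Rightarrow> 'v::ab_group_add \<Rightarrow> 'v"
    and \<alpha>c :: "nat \<Rightarrow> 'h"
    and \<alpha> :: "nat \<Rightarrow> 'h \<Rightarrow> complex"
    and bracket :: "'g \<Rightarrow> 'g \<Rightarrow> 'g"
    and \<iota> :: "'h \<Rightarrow> 'g"
    and e f :: "nat \<Rightarrow> 'g"
    and act :: "'g \<Rightarrow> 'v \<Rightarrow> 'v"
    and \<Lambda>\<^sub>0 :: "'h \<Rightarrow> complex"
  assumes "k \<ge> 1" and "p \<ge> 2"
    and "kac_moody_algebra scaleH p (affine_A p) \<alpha>c \<alpha> scaleG bracket \<iota> e f"
    and "fundamental_weight scaleH p \<alpha>c 0 \<Lambda>\<^sub>0"
    and "irreducible_highest_weight_module scaleH p (affine_A p) \<alpha>c \<alpha>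
           scaleG bracket \<iota> e f scaleV act (fun_scale (of_nat k) \<Lambda>\<^sub>0)"
  shows "real (card (maximal_weights (weights scaleH scaleV act \<iota>) (null_root p \<alpha>)
                      \<inter> dominant_integral_weights scaleH p \<alpha>c))
       = 1 / real (p + k) *
           (\<Sum>d | d dvd k \<and> d dvd p. real (totient d) * real (((p + k) div d) choose (k div d)))"
proof -
  let ?\<Lambda> = "fun_scale (of_nat k) \<Lambda>\<^sub>0"
  interpret M: irreducible_highest_weight_module scaleH p "affine_A p" \<alpha>c \<alpha>
    scaleG bracket \<iota> e f scaleV act ?\<Lambda> by fact
  obtain v where v: "v \<noteq> 0" "v \<in> weight_space scaleV act \<iota> ?\<Lambda>"
    "\<forall>x \<in> lie_generated scaleG bracket (e ` {..<p}). act x v = 0"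
    "\<Inter>{W. submodule scaleV act W \<and> v \<in> W} = UNIV"
    using M.highest_weight_vector by blast
  have e_generated: "e i \<in> lie_generated scaleG bracket (e ` {..<p})" if "i < p" for i
    using that by (auto simp: lie_generated_def)
  interpret affine_A_highest_weight_module scaleH p \<alpha>c \<alpha> scaleG bracket \<iota> e f
    scaleV act ?\<Lambda> v k
  proof unfold_locales
    show "?\<Lambda> \<in> dual_space scaleH" by (rule M.highest_weight_dual)
    show "v \<noteq> 0" "v \<in> weight_space scaleV act \<iota> ?\<Lambda>" by (rule v)+
    show "act (e i) v = 0" if "i < p" for i
      using v(3) e_generated[OF that] by (rule bspec)
    show "W = UNIV" if "submodule scaleV act W" "v \<in> W" for W
      using v(4) that by blast
    show "k \<ge> 1" "p \<ge> 2" by fact+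
    show "?\<Lambda> (\<alpha>c i) = (if i = 0 then of_nat k else 0)" if "i < p" for i
      using assms(4) that by (simp add: fundamental_weight_def fun_scale_def)
  qed
  show ?thesis
    unfolding dominant_maximal_weights card_image[OF inj_on_below]
    using assms(2) by (subst card_reduced_admissible) (simp, rule card_compositions_weighted_sum_dvd, simp)
qed

end
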